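(* Let $f(x):=\frac12\|Ax-b\|_2^2$. For any $\kappa,s\ge1$ and $s'\le 0.6\,s\kappa^2$, there exist a (diagonal) matrix $A\in\mathbb{R}^{n\times n}$ and a vector $b\in\mathbb{R}^n$, where $n=s(\kappa^2+\kappa+1)$, such that $f$ is $1$-strongly convex and $\kappa$-smooth, as well as an $s$-sparse solution $x^*\in\mathbb{R}^n$ and an $s'$-sparse solution $x\in\mathbb{R}^n$, such that $$f(x)\ge f(x^* )+0.1\,s\kappa^2$$ but, with $\beta=\kappa$, $$x=H_{s'}\left(x-\beta^{-1}\nabla f(x)\right),$$ i.e. $x$ is a fixpoint for iterative hard thresholding (IHT).
   Context: Here $\kappa$ plays the role of the condition number (smoothness constant divided by strong convexity constant), $s,s'$ are sparsity levels and $n$ is the dimension. A vector is $s$-sparse if it has at most $s$ non-zero entries. A differentiable $f:\mathbb{R}^n\to\mathbb{R}$ is $\beta$-smooth if $f(y)\le f(x)+\langle\nabla f(x),y-x\rangle+(\beta/2)\|y-x\|_2^2$ for all $x,y$, and $\alpha$-strongly convex if $f(y)\ge f(x)+\langle\nabla f(x),y-x\rangle+(\alpha/2)\|y-x\|_2^2$ for all $x,y$. The hard thresholding operator $H_{s'}(v)$ keeps the $s'$ entries of $v$ of largest absolute value (breaking ties arbitrarily) and sets all other entries to $0$. IHT with sparsity level $s'$ and step size $\beta^{-1}$ iterates $x\mapsto H_{s'}(x-\beta^{-1}\nabla f(x))$. *)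

theory Defs
  imports "HOL-Analysis.Analysis"
begin

definition vec_sparse :: "nat \<Rightarrow> real ^ 'n \<Rightarrow> bool" where
  "vec_sparse k x \<longleftrightarrow> card {i. x $ i \<noteq> 0} \<le> k"

definition diagonal :: "real ^ 'n ^ 'n \<Rightarrow> bool" where
  "diagonal A \<longleftrightarrow> (\<forall>i j. i \<noteq> j \<longrightarrow> A $ i $ j = 0)"

definition grad :: "('a::real_inner \<Rightarrow> real) \<Rightarrow> 'a \<Rightarrow> 'a" where
  "grad f x = (THE g. GDERIV f x :> g)"

text \<open>Both notions below require differentiability everywhere, so \<^const>\<open>grad\<close> is
  only used where the gradient exists.\<close>

definition smooth_with :: "real \<Rightarrow> ('a::real_inner \<Rightarrow> real) \<Rightarrow> bool" where
  "smooth_with \<beta> f \<longleftrightarrow> (\<forall>x. f differentiable (at x)) \<and>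
     (\<forall>x y. f y \<le> f x + grad f x \<bullet> (y - x) + \<beta> / 2 * (norm (y - x))\<^sup>2)"

definition strongly_convex_with :: "real \<Rightarrow> ('a::real_inner \<Rightarrow> real) \<Rightarrow> bool" where
  "strongly_convex_with \<alpha> f \<longleftrightarrow> (\<forall>x. f differentiable (at x)) \<and>
     (\<forall>x y. f y \<ge> f x + grad f x \<bullet> (y - x) + \<alpha> / 2 * (norm (y - x))\<^sup>2)"

text \<open>Hard thresholding breaks ties arbitrarily, so it is modelled as the set of all
  possible outputs, one for each set \<open>S\<close> of positions of \<open>k\<close> entries of largest absolute
  value (of all entries if \<open>k\<close> exceeds the dimension). The set is never empty; it is a
  singleton \<open>{w}\<close> iff every way of breaking ties yields \<open>w\<close>.\<close>

definition hard_threshold :: "nat \<Rightarrow> real ^ 'n \<Rightarrow> (real ^ 'n) set" where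
  "hard_threshold k v =
     {\<chi> i. if i \<in> S then v $ i else 0 | S.
        card S = min k CARD('n) \<and> (\<forall>i\<in>S. \<forall>j. j \<notin> S \<longrightarrow> \<bar>v $ j\<bar> \<le> \<bar>v $ i\<bar>)}"

definition least_squares :: "real ^ 'n ^ 'm \<Rightarrow> real ^ 'm \<Rightarrow> real ^ 'n \<Rightarrow> real" where
  "least_squares A b x = 1 / 2 * (norm (A *v x - b))\<^sup>2"

end

theory Submission
  imports Defs
begin

text \<open>
  Already \<open>A = I\<close> works. Let \<open>b\<close> be \<open>\<kappa>\<close> on a set \<open>T\<close> of \<open>s\<close> coordinates, \<open>1.1\<close> on a disjoint
  set \<open>S\<close> of \<open>s'\<close> coordinates, and \<open>0\<close> elsewhere, and let \<open>x\<close> and \<open>x\<^sup>*\<close> be the restrictions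
  of \<open>b\<close> to \<open>S\<close> and \<open>T\<close>. The gradient vanishes on \<open>S\<close>, and a step of length \<open>1 / \<kappa>\<close> from \<open>x\<close>
  raises the coordinates in \<open>T\<close> only to \<open>1 < 1.1\<close>, so that thresholding must keep \<open>S\<close>. Yet
  \<open>f x - f x\<^sup>* = (s \<kappa>\<^sup>2 - 1.21 s') / 2 \<ge> (1 - 0.726) s \<kappa>\<^sup>2 / 2\<close>.
\<close>

text \<open>The Frechet derivative is unique, and a vector is determined by its inner products with
  all vectors. This gives access to the \<open>THE\<close> in \<open>grad\<close>.\<close>

lemma grad_eqI:
  assumes "GDERIV f x :> g"
  shows "grad f x = g"
  unfolding grad_def
proof (rule the_equality)
  fix g' assume "GDERIV f x :> g'"
  with assms have "(\<lambda>h. h \<bullet> g') = (\<lambda>h. h \<bullet> g)"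
    unfolding gderiv_def by (metis has_derivative_unique)
  then show "g' = g"
    by (metis vector_eq_ldot)
qed (fact assms)

lemma least_squares_mat_1:
  "least_squares (mat 1) b = (\<lambda>x. 1 / 2 * ((x - b) \<bullet> (x - b)))"
  by (simp add: least_squares_def fun_eq_iff dot_square_norm)

lemma GDERIV_least_squares_mat_1:
  "GDERIV (least_squares (mat 1) b) x :> x - b"
  unfolding gderiv_def least_squares_mat_1
  by (auto intro!: derivative_eq_intros simp: inner_commute)

lemma grad_least_squares_mat_1 [simp]: "grad (least_squares (mat 1) b) x = x - b"
  by (rule grad_eqI) (rule GDERIV_least_squares_mat_1)

lemma differentiable_least_squares_mat_1:
  "least_squares (mat 1) b differentiable (at x)"
  using GDERIV_least_squares_mat_1 unfolding gderiv_def differentiable_def by blast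

text \<open>The function is quadratic with Hessian the identity, so its second-order Taylor
  expansion is exact. Strong convexity with constant 1 holds with equality, and smoothness follows
  for every constant at least 1.\<close>

lemma least_squares_mat_1_expand:
  "least_squares (mat 1) b y =
     least_squares (mat 1) b x + (x - b) \<bullet> (y - x) + 1 / 2 * (norm (y - x))\<^sup>2"
  unfolding least_squares_mat_1 dot_square_norm[symmetric]
  by (simp add: inner_diff_left inner_diff_right inner_commute field_simps)

lemma strongly_convex_with_least_squares_mat_1:
  "strongly_convex_with 1 (least_squares (mat 1) b)"
  unfolding strongly_convex_with_def
  using least_squares_mat_1_expand[of b]
  by (simp add: differentiable_least_squares_mat_1)

lemma smooth_with_least_squares_mat_1:
  fixes b :: "real ^ 'n"
  assumes "\<beta> \<ge> 1"
  shows "smooth_with \<beta> (least_squares (mat 1) b)"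
  unfolding smooth_with_def
proof (intro conjI allI)
  fix x y :: "real ^ 'n"
  have "1 / 2 * (norm (y - x))\<^sup>2 \<le> \<beta> / 2 * (norm (y - x))\<^sup>2"
    using assms by (intro mult_right_mono) auto
  then show "least_squares (mat 1) b y \<le> least_squares (mat 1) b x
      + grad (least_squares (mat 1) b) x \<bullet> (y - x) + \<beta> / 2 * (norm (y - x))\<^sup>2"
    unfolding least_squares_mat_1_expand[of b y x] by simp
qed (fact differentiable_least_squares_mat_1)

text \<open>The residual vanishes on \<open>S\<close> and equals \<open>- b\<close>
  elsewhere.\<close>

lemma least_squares_mat_1_restrict:
  fixes b :: "real ^ 'n"
  shows "least_squares (mat 1) b (\<chi> i. if i \<in> S then b $ i else 0) =
    1 / 2 * (\<Sum>i\<in>- S. (b $ i)\<^sup>2)"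
proof -
  have "(\<Sum>i\<in>UNIV. ((if i \<in> S then b $ i else 0) - b $ i)\<^sup>2) = (\<Sum>i\<in>- S. (b $ i)\<^sup>2)"
    by (intro sum.mono_neutral_cong_right) auto
  then show ?thesis
    by (simp add: least_squares_mat_1 inner_vec_def power2_eq_square)
qed

lemma vec_sparse_restrict:
  fixes b :: "real ^ 'n"
  shows "vec_sparse (card S) (\<chi> i. if i \<in> S then b $ i else 0)"
  unfolding vec_sparse_def by (rule card_mono) auto

text \<open>A strict gap excludes ties: a different set of the same finite size misses some
  \<open>j\<close> in \<open>S\<close> and contains some \<open>i\<close> outside \<open>S\<close>,
  although the entry at \<open>j\<close> is strictly larger in absolute value.\<close>

lemma hard_threshold_unique:
  fixes v :: "real ^ 'n"
  assumes gap: "\<And>i j. i \<in> S \<Longrightarrow> j \<notin> S \<Longrightarrow> \<bar>v $ j\<bar> < \<bar>v $ i\<bar>"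
  shows "hard_threshold (card S) v = {\<chi> i. if i \<in> S then v $ i else 0}"
proof -
  \<comment> \<open>This resolves the \<open>min\<close> in \<open>hard_threshold\<close> to
    \<open>card S\<close>.\<close>
  have card_le: "card S \<le> CARD('n)"
    by (rule card_mono) auto
  have "S' = S" if "card S' = card S"
    and top: "\<forall>i\<in>S'. \<forall>j. j \<notin> S' \<longrightarrow> \<bar>v $ j\<bar> \<le> \<bar>v $ i\<bar>" for S'
  proof (rule ccontr)
    assume "S' \<noteq> S"
    with \<open>card S' = card S\<close> have "\<not> S' \<subseteq> S" "\<not> S \<subseteq> S'"
      by (metis card_subset_eq finite)+
    then obtain i j where "i \<in> S'" "i \<notin> S" "j \<in> S" "j \<notin> S'"
      by blast
    with gap[of j i] top show False
      by force
  qed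
  moreover have "\<forall>i\<in>S. \<forall>j. j \<notin> S \<longrightarrow> \<bar>v $ j\<bar> \<le> \<bar>v $ i\<bar>"
    using gap by (meson less_imp_le)
  ultimately show ?thesis
    unfolding hard_threshold_def using card_le by (auto simp: min_def)
qed

theorem lemmaD1:
  fixes \<kappa> :: real and s s' :: nat
  assumes "\<kappa> \<ge> 1" and "s \<ge> 1"
    and "real s' \<le> 0.6 * real s * \<kappa>\<^sup>2"
    and "real CARD('n::finite) = real s * (\<kappa>\<^sup>2 + \<kappa> + 1)"
  shows "\<exists>(A :: real ^ 'n ^ 'n) (b :: real ^ 'n).
     diagonal A \<and>
     strongly_convex_with 1 (least_squares A b) \<and>
     smooth_with \<kappa> (least_squares A b) \<and>
     (\<exists>(xstar :: real ^ 'n) (x :: real ^ 'n).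
        vec_sparse s xstar \<and> vec_sparse s' x \<and>
        least_squares A b x \<ge> least_squares A b xstar + 0.1 * real s * \<kappa>\<^sup>2 \<and>
        hard_threshold s' (x - (1 / \<kappa>) *\<^sub>R grad (least_squares A b) x) = {x})"
proof -
  have nonneg: "0 \<le> real s * \<kappa>\<^sup>2" "0 \<le> real s * \<kappa>"
    using assms(1) by auto
  \<comment> \<open>The dimension leaves room for disjoint \<open>T\<close> and \<open>S\<close>, as
    \<open>s + 0.6 * s * \<kappa>\<^sup>2\<close> is at most
    \<open>s * (\<kappa>\<^sup>2 + \<kappa> + 1)\<close>.\<close>
  have "real (s + s') \<le> real CARD('n)"
    using assms(3,4) nonneg by (simp add: distrib_left)
  then have "s + s' \<le> CARD('n)"
    by (simp only: of_nat_le_iff)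
  then obtain T :: "'n set" where T: "card T = s"
    by (metis add_leD1 obtain_subset_with_card_n)
  have "s' \<le> card (- T)"
    using \<open>s + s' \<le> CARD('n)\<close> T by (simp add: Compl_eq_Diff_UNIV card_Diff_subset)
  then obtain S where S: "S \<subseteq> - T" "card S = s'"
    by (metis obtain_subset_with_card_n)
  \<comment> \<open>Any constant c > 1 with c^2 \<le> 4/3 could replace 11/10: the first bound makes
    the gap strict, the second keeps (1 - 0.6 c^2) / 2 at least 0.1.\<close>
  define b :: "real ^ 'n" where
    "b = (\<chi> i. if i \<in> T then \<kappa> else if i \<in> S then 11 / 10 else 0)"
  define x :: "real ^ 'n" where "x = (\<chi> i. if i \<in> S then b $ i else 0)"
  define xstar :: "real ^ 'n" where "xstar = (\<chi> i. if i \<in> T then b $ i else 0)"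
  define f where "f = least_squares (mat 1) b"
  define v where "v = x - (1 / \<kappa>) *\<^sub>R grad f x"
  have "(\<Sum>i\<in>- S. (b $ i)\<^sup>2) = (\<Sum>i\<in>T. \<kappa>\<^sup>2)"
    using S(1) by (intro sum.mono_neutral_cong_right) (auto simp: b_def)
  then have fx: "f x = real s * \<kappa>\<^sup>2 / 2"
    unfolding f_def x_def least_squares_mat_1_restrict by (simp add: T)
  have "(\<Sum>i\<in>- T. (b $ i)\<^sup>2) = (\<Sum>i\<in>S. (11 / 10)\<^sup>2)"
    using S(1) by (intro sum.mono_neutral_cong_right) (auto simp: b_def)
  then have fxstar: "f xstar = 121 / 200 * real s'"
    unfolding f_def xstar_def least_squares_mat_1_restrict by (simp add: S power2_eq_square)
  \<comment> \<open>On \<open>S\<close> the gradient is 0; on \<open>T\<close>, where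
    \<open>x\<close> is 0, it is \<open>- \<kappa>\<close>, and the step size scales this to an
    increase of exactly 1; elsewhere both \<open>x\<close> and \<open>b\<close> vanish.\<close>
  have v: "v $ i = (if i \<in> S then 11 / 10 else if i \<in> T then 1 else 0)" for i
    using S(1) assms(1) by (auto simp: v_def f_def x_def b_def)
  have "hard_threshold s' v = {\<chi> i. if i \<in> S then v $ i else 0}"
    unfolding S(2)[symmetric] by (rule hard_threshold_unique) (auto simp: v)
  also have "(\<chi> i. if i \<in> S then v $ i else 0) = x"
    using S(1) by (auto simp: x_def v b_def vec_eq_iff)
  finally have "hard_threshold s' v = {x}" .
  moreover have "f x \<ge> f xstar + 0.1 * real s * \<kappa>\<^sup>2"
    using assms(3) nonneg(1) unfolding fx fxstar by simp
  moreover have "vec_sparse s xstar" "vec_sparse s' x"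
    unfolding x_def xstar_def T[symmetric] S(2)[symmetric] by (rule vec_sparse_restrict)+
  moreover have "diagonal (mat 1 :: real ^ 'n ^ 'n)"
    by (simp add: diagonal_def mat_def)
  ultimately show ?thesis
    using strongly_convex_with_least_squares_mat_1[of b]
      smooth_with_least_squares_mat_1[OF assms(1), of b]
    unfolding v_def f_def by blast
qed

end
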